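(* Let $0<q<1$, $\lambda\in\mathbb{R}$, let $a$ and $x$ be nonzero complex numbers with $w(x;a;q):=(qx;q)_\infty(a^{-1}qx;q)_\infty\neq 0$. Define the fractional Al Salam-Carlitz I function by $$U^{(a)}_{\lambda}(x;q)=\frac{a^\lambda q^{\frac{\lambda(\lambda-3)}{2}}(1-q)^{\lambda}}{w(x;a;q)}\,D_{q^{-1}}^{\lambda}\left[w(x;a;q)\right],$$ whenever the series defining $D_{q^{-1}}^\lambda$ (acting in the variable $x$) converges. Then, whenever it is defined, $$U^{(a)}_{\lambda}(x;q)=(-a)^\lambda q^{\frac{\lambda(\lambda-1)}{2}}x^{-\lambda}\;{}_3\phi_0\!\left(\begin{matrix}q^{-\lambda},\,x^{-1},\,ax^{-1}\\ -\end{matrix}\,\middle|\,q;\frac{q^{\lambda}x^2}{a}\right).$$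
   Context: Notation: $(s;q)_n=\prod_{j=0}^{n-1}(1-sq^j)$ and $(s;q)_\infty=\prod_{j=0}^\infty(1-sq^j)$. The basic hypergeometric series here is $${}_3\phi_0\!\left(\begin{matrix}a_1,a_2,a_3\\ -\end{matrix}\,\middle|\,q;z\right)=\sum_{n=0}^\infty(a_1;q)_n(a_2;q)_n(a_3;q)_n\left((-1)^nq^{\binom n2}\right)^{-2}\frac{z^n}{(q;q)_n}.$$ The fractional operator $D_{q^{-1}}^\lambda$ is $$D_{q^{-1}}^{\lambda}f(x)=\frac{q^{\lambda}}{(q-1)^\lambda x^\lambda}\sum_{k=0}^\infty\frac{(q^{-\lambda};q)_{k}}{(q;q)_k}q^{\lambda k}f(xq^{-k}),$$ provided the series converges. Powers with non-integer exponent are taken with fixed branches, with the convention that $(-a)^\lambda$ stands for $a^\lambda(1-q)^\lambda/(q-1)^\lambda$ (which agrees with principal values when $a<0$). *)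

theory Defs
  imports "HOL-Analysis.Analysis"
begin

definition qpoch :: "complex \<Rightarrow> real \<Rightarrow> nat \<Rightarrow> complex" where
  "qpoch s q n = (\<Prod>j<n. 1 - s * of_real q ^ j)"

definition qpoch_inf :: "complex \<Rightarrow> real \<Rightarrow> complex" where
  "qpoch_inf s q = (\<Prod>j. 1 - s * of_real q ^ j)"

definition phi30_term ::
  "complex \<Rightarrow> complex \<Rightarrow> complex \<Rightarrow> real \<Rightarrow> complex \<Rightarrow> nat \<Rightarrow> complex" where
  "phi30_term a1 a2 a3 q z n =
     qpoch a1 q n * qpoch a2 q n * qpoch a3 q n
       * ((-1) ^ n * of_real q ^ (n choose 2)) powi (-2)
       * (z ^ n / qpoch (of_real q) q n)"

definition phi30 ::
  "complex \<Rightarrow> complex \<Rightarrow> complex \<Rightarrow> real \<Rightarrow> complex \<Rightarrow> complex" where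
  "phi30 a1 a2 a3 q z = (\<Sum>n. phi30_term a1 a2 a3 q z n)"

text \<open>
  Real powers of nonzero complex numbers depend on a branch of the logarithm. Such a branch is
  represented by an arbitrary pointwise choice \<open>L\<close> of logarithms; \<open>L = Ln\<close> gives the principal
  values. Powers of the positive reals \<open>q\<close> and \<open>1 - q\<close> are always the positive real ones
  and are written with the real \<open>powr\<close> below.
\<close>

definition log_branch :: "(complex \<Rightarrow> complex) \<Rightarrow> bool" where
  "log_branch L \<longleftrightarrow> (\<forall>z. z \<noteq> 0 \<longrightarrow> exp (L z) = z)"

definition bpow :: "(complex \<Rightarrow> complex) \<Rightarrow> complex \<Rightarrow> real \<Rightarrow> complex" where
  "bpow L z r = exp (of_real r * L z)"

text \<open>
  The power \<open>(-a)\<^sup>r\<close> is by convention \<open>a\<^sup>r (1 - q)\<^sup>r / (q - 1)\<^sup>r\<close>, which need not be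
  \<open>bpow L (-a) r\<close>. For principal values and negative real \<open>a\<close> the two agree
  (lemma \<open>neg_bpow_Ln\<close>).
\<close>

definition neg_bpow :: "(complex \<Rightarrow> complex) \<Rightarrow> real \<Rightarrow> complex \<Rightarrow> real \<Rightarrow> complex" where
  "neg_bpow L q a r =
     bpow L a r * of_real ((1 - q) powr r) / bpow L (of_real (q - 1)) r"

lemma log_branch_Ln: "log_branch Ln"
  by (simp add: log_branch_def)

lemma bpow_Ln: "z \<noteq> 0 \<Longrightarrow> bpow Ln z r = z powr of_real r"
  by (simp add: bpow_def powr_def)

lemma neg_bpow_Ln:
  assumes "q < 1" and "t < 0"
  shows "neg_bpow Ln q (of_real t) r = of_real ((- t) powr r)"
proof -
  have L: "Ln (of_real s) = of_real (ln (- s)) + \<i> * of_real pi" if "s < 0" for s :: real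
    using Ln_minus[of "of_real (- s)"] Ln_of_real[of "- s"] that by auto
  show ?thesis
    unfolding neg_bpow_def bpow_def
    using assms L[of t] L[of "q - 1"]
    by (simp add: powr_def distrib_left exp_add exp_of_real flip: of_real_mult)
qed

text \<open>The operator \<open>D\<close> of order \<open>r\<close> in base \<open>1/q\<close>; \<open>qfracD_term\<close> gives the terms of its series.\<close>

definition qfracD_term ::
  "real \<Rightarrow> real \<Rightarrow> (complex \<Rightarrow> complex) \<Rightarrow> complex \<Rightarrow> nat \<Rightarrow> complex" where
  "qfracD_term q r f x k =
     qpoch (of_real (q powr (- r))) q k / qpoch (of_real q) q k
       * of_real (q powr (r * real k)) * f (x * of_real q powi (- int k))"

definition qfracD ::
  "(complex \<Rightarrow> complex) \<Rightarrow> real \<Rightarrow> real \<Rightarrow> (complex \<Rightarrow> complex) \<Rightarrow> complex \<Rightarrow> complex" where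
  "qfracD L q r f x =
     of_real (q powr r) / (bpow L (of_real (q - 1)) r * bpow L x r)
       * (\<Sum>k. qfracD_term q r f x k)"

definition asc_weight :: "complex \<Rightarrow> real \<Rightarrow> complex \<Rightarrow> complex" where
  "asc_weight a q x = qpoch_inf (of_real q * x) q * qpoch_inf (inverse a * of_real q * x) q"

definition frac_al_salam_carlitz ::
  "(complex \<Rightarrow> complex) \<Rightarrow> complex \<Rightarrow> real \<Rightarrow> real \<Rightarrow> complex \<Rightarrow> complex" where
  "frac_al_salam_carlitz L a q r x =
     bpow L a r * of_real (q powr (r * (r - 3) / 2)) * of_real ((1 - q) powr r)
       / asc_weight a q x * qfracD L q r (asc_weight a q) x"

end

theory Submission
  imports Defs
begin

text \<open>
  Shifting the argument of the infinite product by \<open>q\<^sup>-\<^sup>k\<close> exposes \<open>k\<close> extra factors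
  \<open>1 - x q\<^sup>-\<^sup>i = (- x q\<^sup>-\<^sup>i) (1 - x\<^sup>-\<^sup>1 q\<^sup>i)\<close>. Hence the two series agree term by term up to
  the factor \<open>w(x; a; q)\<close>.
\<close>

text \<open>The first factor splits off every partial product, and the limit preserves this.
  Convergence comes from absolute summability of the geometric series, so vanishing factors cause no
  trouble.\<close>

lemma qpoch_inf_rec:
  assumes "\<bar>q\<bar> < 1"
  shows "qpoch_inf s q = (1 - s) * qpoch_inf (s * of_real q) q"
proof -
  have lim: "(\<lambda>n. \<Prod>j\<le>n. 1 - t * of_real q ^ j) \<longlonglongrightarrow> qpoch_inf t q" for t
  proof -
    have "summable (\<lambda>j. norm (t * of_real q ^ j))"
      using assms by (simp add: norm_mult norm_power summable_mult summable_geometric)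
    then have "convergent_prod (\<lambda>j. 1 + - (t * of_real q ^ j))"
      by (intro abs_convergent_prod_imp_convergent_prod summable_imp_abs_convergent_prod) simp
    then show ?thesis
      unfolding qpoch_inf_def by (intro convergent_prod_LIMSEQ) simp
  qed
  have "(\<Prod>j\<le>Suc n. 1 - s * of_real q ^ j)
      = (1 - s) * (\<Prod>j\<le>n. 1 - (s * of_real q) * of_real q ^ j)" for n
    by (subst prod.atMost_Suc_shift) (simp add: mult.assoc)
  then have "(\<lambda>n. \<Prod>j\<le>Suc n. 1 - s * of_real q ^ j)
      \<longlonglongrightarrow> (1 - s) * qpoch_inf (s * of_real q) q"
    using tendsto_mult_left[OF lim] by simp
  with LIMSEQ_Suc[OF lim[of s]] show ?thesis
    using LIMSEQ_unique by blast
qed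

text \<open>The exposed factors have \<open>i < k\<close>, so the powers of \<open>q\<close> pulled
  out of them have exponents 0, ..., k - 1, which add up to \<open>k choose 2\<close>.\<close>

lemma qpoch_inf_shift:
  assumes "0 < q" "q < 1" "x \<noteq> 0"
  shows "qpoch_inf (of_real q * (x * of_real q powi (- int k))) q
    = (- x) ^ k / of_real q ^ (k choose 2) * qpoch (inverse x) q k * qpoch_inf (of_real q * x) q"
proof (induction k)
  case 0
  show ?case by (simp add: qpoch_def numeral_2_eq_2)
next
  case (Suc k)
  let ?Q = "of_real q :: complex"
  have Q: "?Q \<noteq> 0" using assms by simp
  have shift: "?Q * (x * ?Q powi (- int (Suc k))) = x * ?Q powi (- int k)"
    unfolding power_int_minus power_int_of_nat using Q by (simp add: field_simps)
  \<comment> \<open>The one new factor, turned around so that it supplies the next factor of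
    \<open>qpoch (inverse x) q\<close>.\<close>
  have "1 - x * ?Q powi (- int k) = - x / ?Q ^ k * (1 - inverse x * ?Q ^ k)"
    using Q assms by (simp add: power_int_minus field_simps)
  moreover have "qpoch_inf (x * ?Q powi (- int k)) q
      = (1 - x * ?Q powi (- int k)) * qpoch_inf (?Q * (x * ?Q powi (- int k))) q"
    using qpoch_inf_rec[of q "x * ?Q powi (- int k)"] assms by (simp add: mult_ac)
  moreover have "Suc k choose 2 = k + (k choose 2)"
    by (simp add: numeral_2_eq_2)
  ultimately show ?case
    unfolding shift Suc.IH by (simp add: qpoch_def power_add mult_ac)
qed

lemma qfracD_term_asc_weight:
  assumes "0 < q" "q < 1" "a \<noteq> 0" "x \<noteq> 0"
  shows "qfracD_term q r (asc_weight a q) x k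
    = asc_weight a q x * phi30_term (of_real (q powr (- r))) (inverse x) (a * inverse x) q
        (of_real (q powr r) * x\<^sup>2 / a) k"
proof -
  let ?Q = "of_real q :: complex"
  have "asc_weight a q (x * ?Q powi (- int k))
      = ((- x) ^ k / ?Q ^ (k choose 2) * qpoch (inverse x) q k * qpoch_inf (?Q * x) q)
        * ((- (x / a)) ^ k / ?Q ^ (k choose 2) * qpoch (a * inverse x) q k
          * qpoch_inf (inverse a * ?Q * x) q)"
    \<comment> \<open>The second product of the weight is the first one at \<open>x / a\<close>,
      whose inverse is the parameter \<open>a * inverse x\<close>.\<close>
    using qpoch_inf_shift[of q x k] qpoch_inf_shift[of q "x / a" k] assms
    by (simp add: asc_weight_def field_simps)
  moreover have "(- x) ^ k * (- (x / a)) ^ k = (x\<^sup>2 / a) ^ k"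
    by (simp add: power_mult_distrib[symmetric] power2_eq_square)
  ultimately have w: "asc_weight a q (x * ?Q powi (- int k))
      = asc_weight a q x * (x\<^sup>2 / a) ^ k / (?Q ^ (k choose 2))\<^sup>2
        * qpoch (inverse x) q k * qpoch (a * inverse x) q k"
    by (simp add: asc_weight_def power2_eq_square)
  have "of_real (q powr (r * real k)) = (of_real (q powr r) :: complex) ^ k"
    using assms by (simp add: powr_powr[symmetric] powr_realpow)
  \<comment> \<open>Each product of the weight contributes one of the two inverse powers; the signs
    vanish on squaring.\<close>
  moreover have "((- 1) ^ k * ?Q ^ (k choose 2)) powi (- 2) = 1 / (?Q ^ (k choose 2))\<^sup>2"
    by (simp add: power_int_minus power_mult_distrib power2_eq_square field_simps)
  moreover have "(of_real (q powr r) * x\<^sup>2 / a) ^ k = (of_real (q powr r)) ^ k * (x\<^sup>2 / a) ^ k"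
    by (simp add: power_mult_distrib power_divide)
  ultimately show ?thesis
    unfolding qfracD_term_def phi30_term_def w by (simp add: mult_ac)
qed

text \<open>"Whenever it is defined" is the summability hypothesis. Summability of the right-hand
  series is part of the conclusion, since \<open>suminf\<close> alone would not assert it.\<close>

theorem proposition14:
  fixes q lam :: real and a x :: complex and L :: "complex \<Rightarrow> complex"
  assumes "0 < q" and "q < 1"
    and "a \<noteq> 0" and "x \<noteq> 0"
    and "asc_weight a q x \<noteq> 0"
    and "log_branch L"
    and "summable (qfracD_term q lam (asc_weight a q) x)"
  shows "summable (phi30_term (of_real (q powr (- lam))) (inverse x) (a * inverse x) q
             (of_real (q powr lam) * x\<^sup>2 / a))
       \<and> frac_al_salam_carlitz L a q lam x =
           neg_bpow L q a lam * of_real (q powr (lam * (lam - 1) / 2)) * bpow L x (- lam)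
             * phi30 (of_real (q powr (- lam))) (inverse x) (a * inverse x) q
                 (of_real (q powr lam) * x\<^sup>2 / a)"
proof
  let ?w = "asc_weight a q x"
  let ?t = "phi30_term (of_real (q powr (- lam))) (inverse x) (a * inverse x) q
             (of_real (q powr lam) * x\<^sup>2 / a)"
  have D: "qfracD_term q lam (asc_weight a q) x = (\<lambda>k. ?w * ?t k)"
    using qfracD_term_asc_weight assms by blast
  \<comment> \<open>Summability passes back to \<open>?t\<close> because the constant factor
    \<open>?w\<close> is nonzero.\<close>
  with assms show s: "summable ?t"
    by (simp add: summable_cmult_iff)
  have sum: "(\<Sum>k. qfracD_term q lam (asc_weight a q) x k) = ?w * suminf ?t"
    unfolding D by (rule suminf_mult[OF s])
  \<comment> \<open>The extra \<open>lam\<close> is the exponent in the prefactor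
    \<open>q powr lam\<close> of \<open>qfracD\<close>.\<close>
  have "lam * (lam - 1) / 2 = lam * (lam - 3) / 2 + lam"
    by (simp add: field_simps)
  then have "q powr (lam * (lam - 1) / 2) = q powr (lam * (lam - 3) / 2) * q powr lam"
    by (simp only: powr_add)
  \<comment> \<open>Both powers use the same logarithm \<open>L x\<close>, so they are exact
    reciprocals for any branch.\<close>
  moreover have "bpow L x (- lam) = 1 / bpow L x lam"
    by (simp add: bpow_def exp_minus field_simps)
  ultimately show "frac_al_salam_carlitz L a q lam x =
           neg_bpow L q a lam * of_real (q powr (lam * (lam - 1) / 2)) * bpow L x (- lam)
             * phi30 (of_real (q powr (- lam))) (inverse x) (a * inverse x) q
                 (of_real (q powr lam) * x\<^sup>2 / a)"
    unfolding frac_al_salam_carlitz_def qfracD_def sum neg_bpow_def phi30_def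
    using assms(5) by simp
qed

end
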